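(* Let $h\ge1$, let $n,d_0,d_1,\dots,d_h$ be positive integers with $d_0>n$ and $d_i\le d_{i-1}$ for $1\le i\le h$, let $X\in\mathbb{R}^{d_0\times n}$ have full column rank, let $\sigma_i:\mathbb{R}\to\mathbb{R}$ ($1\le i\le h$) be continuous and strictly monotone, and let $\ell:\mathbb{R}^{d_h\times n}\to\mathbb{R}$ be convex. For $W=(W_1,\dots,W_h)$ with $W_i\in\mathbb{R}^{d_i\times d_{i-1}}$ define $\mathcal{F}_1(W)=\sigma_1(W_1X)$ and $\mathcal{F}_i(W)=\sigma_i(W_i\mathcal{F}_{i-1}(W))$ for $2\le i\le h$. If $\bar W=(\bar W_1,\dots,\bar W_h)$ is a local minimum of the problem $\min_W\ell(\mathcal{F}_h(W))$ and every $\bar W_i$ has full row rank, then $\bar W$ is a global minimum of this problem.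
   Context: The functions $\sigma_i$ are applied to matrices entrywise: $\sigma_i(A)=[\sigma_i(A_{jk})]_{j,k}$. No differentiability of $\sigma_i$ or $\ell$ is assumed. *)

theory Defs
  imports Complex_Main "HOL-Library.FuncSet" "Jordan_Normal_Form.DL_Rank"
begin

text \<open>Layer widths are \<open>d 0, \<dots>, d h\<close>; a parameter tuple \<open>(W\<^sub>1, \<dots>, W\<^sub>h)\<close> is a function on
  \<open>{1..h}\<close>, extensional outside it so that distinct functions are distinct tuples.\<close>

definition weight_space :: "nat \<Rightarrow> (nat \<Rightarrow> nat) \<Rightarrow> (nat \<Rightarrow> real mat) set" where
  "weight_space h d = (\<Pi>\<^sub>E i\<in>{1..h}. carrier_mat (d i) (d (i - 1)))"

text \<open>Starting the recursion at \<open>F\<^sub>0 = X\<close> gives \<open>F\<^sub>1 = \<sigma>\<^sub>1 (W\<^sub>1 X)\<close>.\<close>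

fun layer :: "(nat \<Rightarrow> real \<Rightarrow> real) \<Rightarrow> real mat \<Rightarrow> (nat \<Rightarrow> real mat) \<Rightarrow> nat \<Rightarrow> real mat" where
  "layer \<sigma> X W 0 = X"
| "layer \<sigma> X W (Suc i) = map_mat (\<sigma> (Suc i)) (W (Suc i) * layer \<sigma> X W i)"

definition strictly_monotone :: "(real \<Rightarrow> real) \<Rightarrow> bool" where
  "strictly_monotone f \<longleftrightarrow> strict_mono f \<or> monotone (<) (>) f"

text \<open>The type of matrices of all sizes is not a real vector space, so \<^const>\<open>carrier_mat\<close>
  has to be named explicitly in the notion of a convex function on \<open>r \<times> c\<close> matrices.\<close>

definition convex_on_carrier_mat :: "nat \<Rightarrow> nat \<Rightarrow> (real mat \<Rightarrow> real) \<Rightarrow> bool" where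
  "convex_on_carrier_mat r c f \<longleftrightarrow>
     (\<forall>A\<in>carrier_mat r c. \<forall>B\<in>carrier_mat r c. \<forall>u\<ge>0. \<forall>v\<ge>0. u + v = 1 \<longrightarrow>
        f (u \<cdot>\<^sub>m A + v \<cdot>\<^sub>m B) \<le> u * f A + v * f B)"

text \<open>Euclidean distance on the product of the matrix spaces.\<close>

definition weight_dist ::
  "nat \<Rightarrow> (nat \<Rightarrow> nat) \<Rightarrow> (nat \<Rightarrow> real mat) \<Rightarrow> (nat \<Rightarrow> real mat) \<Rightarrow> real" where
  "weight_dist h d V W =
     sqrt (\<Sum>i=1..h. \<Sum>j<d i. \<Sum>k<d (i - 1). (V i $$ (j, k) - W i $$ (j, k))\<^sup>2)"

definition local_minimum ::
  "nat \<Rightarrow> (nat \<Rightarrow> nat) \<Rightarrow> ((nat \<Rightarrow> real mat) \<Rightarrow> real) \<Rightarrow> (nat \<Rightarrow> real mat) \<Rightarrow> bool" where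
  "local_minimum h d L W \<longleftrightarrow> W \<in> weight_space h d \<and>
     (\<exists>\<epsilon>>0. \<forall>V\<in>weight_space h d. weight_dist h d V W < \<epsilon> \<longrightarrow> L W \<le> L V)"

definition global_minimum ::
  "nat \<Rightarrow> (nat \<Rightarrow> nat) \<Rightarrow> ((nat \<Rightarrow> real mat) \<Rightarrow> real) \<Rightarrow> (nat \<Rightarrow> real mat) \<Rightarrow> bool" where
  "global_minimum h d L W \<longleftrightarrow> W \<in> weight_space h d \<and> (\<forall>V\<in>weight_space h d. L W \<le> L V)"

end

theory Submission
  imports Defs
begin

text \<open>
  Near \<open>W\<close> the network can produce every output close to its present one, and it can do so by
  moving \<open>W\<^sub>1\<close> alone. Given a small change of the output of layer \<open>i \<ge> 2\<close>, the inverse of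
  \<open>\<sigma>\<^sub>i\<close>, which is continuous because \<open>\<sigma>\<^sub>i\<close> is continuous and strictly monotone, turns it
  into a small change \<open>D\<close> of the product \<open>W\<^sub>i F\<close>, with \<open>F\<close> the output of layer \<open>i - 1\<close>. If
  \<open>R\<close> is a right inverse of the full-row-rank matrix \<open>W\<^sub>i\<close>, then replacing \<open>F\<close> by
  \<open>F + R D\<close> causes exactly the change \<open>D\<close>, so the demand has been passed one layer down. At the
  bottom a small change \<open>D\<close> of \<open>W\<^sub>1 X\<close> is met by replacing \<open>W\<^sub>1\<close> by \<open>W\<^sub>1 + D P\<close>, where
  \<open>P\<close> is a left inverse of \<open>X\<close>. This descent is \<open>layer_curve_lift\<close>, phrased for
  curves: every curve of matrices that converges to the output of a layer is eventually realised by
  weights that converge to \<open>W\<close>.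

  Global optimality then follows from convexity. Let \<open>L\<close> be the output at \<open>W\<close> and \<open>Z\<close> any matrix
  of the same shape, be it in the range of the network or not. For small \<open>t > 0\<close> the point
  \<open>(1 - t) L + t Z\<close> is the output for weights close to \<open>W\<close>, so local minimality and convexity give
  \<open>l L \<le> (1 - t) l L + t l Z\<close>, that is \<open>l L \<le> l Z\<close>.
\<close>

section \<open>One-sided inverses of real matrices of full rank\<close>

lemma (in vec_space) max_indpt_columns:
  assumes "A \<in> carrier_mat n nc"
  obtains S where "S \<subseteq> set (cols A)" "lin_indpt S" "card S = rank A"
proof -
  have "\<exists>S. finite S \<and> maximal S (\<lambda>T. T \<subseteq> set (cols A) \<and> lin_indpt T) \<and> {} \<subseteq> S"
    by (rule maximal_exists_superset[of "set (cols A)"]) (auto simp: lin_dep_def)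
  then obtain S where S: "maximal S (\<lambda>T. T \<subseteq> set (cols A) \<and> lin_indpt T)"
    by blast
  from S have "S \<subseteq> set (cols A)" "lin_indpt S"
    by (auto simp: maximal_def)
  moreover have "card S = rank A"
    using rank_card_indpt[OF assms S] by simp
  ultimately show ?thesis by (rule that)
qed

lemma (in vec_space) full_row_rank_right_inverse:
  assumes A: "A \<in> carrier_mat n nc" and rank: "rank A = n"
  obtains R where "R \<in> carrier_mat nc n" "A * R = 1\<^sub>m n"
proof -
  have cols: "set (cols A) \<subseteq> carrier_vec n"
    using A cols_dim by blast
  obtain S where S: "S \<subseteq> set (cols A)" "lin_indpt S" "card S = n"
    using max_indpt_columns[OF A] rank by metis
  have "finite S" using S(1) finite_subset by blast
  \<comment> \<open>\<open>n\<close> independent columns span the whole space, so every equation \<open>A c = v\<close> is solvable;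
      the columns of \<open>R\<close> are solutions for the unit vectors.\<close>
  then have "basis S"
    using dim_li_is_basis[of S] S cols fin_dim dim_is_n by auto
  then have "carrier_vec n \<subseteq> span (set (cols A))"
    using span_is_monotone[OF S(1)] unfolding basis_def by auto
  moreover have "\<exists>c. A *\<^sub>v vec nc c = v" if v: "v \<in> span (set (cols A))" for v
  proof -
    obtain f where "v = lincomb f (set (cols A))"
      using finite_in_span[OF _ cols v] by auto
    then obtain c where "v = lincomb_list c (cols A)"
      using lincomb_as_lincomb_list[OF cols, of f] by (intro that) simp
    also have "\<dots> = mat_of_cols n (cols A) *\<^sub>v vec (length (cols A)) c"
      using cols by (intro lincomb_list_as_mat_mult) auto
    also have "\<dots> = A *\<^sub>v vec nc c"
      using A mat_of_cols_cols[of A] by simp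
    finally show ?thesis by metis
  qed
  ultimately have "\<forall>j. \<exists>c. A *\<^sub>v vec nc c = unit_vec n j"
    by (meson subsetD unit_vec_carrier)
  then obtain c where c: "\<And>j. A *\<^sub>v vec nc (c j) = unit_vec n j"
    by metis
  define R where "R = mat nc n (\<lambda>(i, j). c j i)"
  have R: "R \<in> carrier_mat nc n" by (simp add: R_def)
  have col: "col R j = vec nc (c j)" if "j < n" for j
    using that by (auto simp: R_def)
  have "A * R = 1\<^sub>m n"
  proof (rule mat_col_eqI)
    fix j assume "j < dim_col (1\<^sub>m n :: 'a mat)"
    then have j: "j < n" by simp
    then show "col (A * R) j = col (1\<^sub>m n) j"
      using col_mult2[OF A R j] col[OF j] c by simp
  qed (use A R in auto)
  with R show ?thesis by (rule that)
qed

text \<open>Over the reals \<open>A\<^sup>T A v = 0\<close> forces \<open>\<parallel>A v\<parallel>\<^sup>2 = 0\<close>, so the Gram matrix of an injective \<open>A\<close> is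
  invertible and \<open>(A\<^sup>T A)\<^sup>-\<^sup>1 A\<^sup>T\<close> is a left inverse.\<close>

lemma full_column_rank_left_inverse:
  fixes A :: "real mat"
  assumes A: "A \<in> carrier_mat n nc" and rank: "vec_space.rank n A = nc"
  obtains P where "P \<in> carrier_mat nc n" "P * A = 1\<^sub>m nc"
proof -
  interpret vec_space "TYPE(real)" n .
  have At: "transpose_mat A \<in> carrier_mat nc n" using A by simp
  let ?G = "transpose_mat A * A"
  have G: "?G \<in> carrier_mat nc nc" using A by simp
  obtain S where S: "S \<subseteq> set (cols A)" "lin_indpt S" "card S = nc"
    using max_indpt_columns[OF A] rank by metis
  have "nc \<le> card (set (cols A))"
    using S card_mono[of "set (cols A)" S] by auto
  moreover have "length (cols A) = nc" using A by simp
  \<comment> \<open>A set forgets repeated columns; only the count \<open>card S = nc\<close> rules them out.\<close>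
  ultimately have dist: "distinct (cols A)"
    using card_length[of "cols A"] by (intro card_distinct) simp
  have indpt: "lin_indpt (set (cols A))"
    using full_rank_lin_indpt[OF A rank dist] .
  have "det ?G \<noteq> 0"
  proof
    assume "det ?G = 0"
    then obtain v where v: "v \<in> carrier_vec nc" "v \<noteq> 0\<^sub>v nc" "?G *\<^sub>v v = 0\<^sub>v nc"
      using det_0_iff_vec_prod_zero_field[OF G] by blast
    have Av: "A *\<^sub>v v \<in> carrier_vec n" using A v by simp
    have "(A *\<^sub>v v) \<bullet> (A *\<^sub>v v) = v \<bullet> (transpose_mat A *\<^sub>v (A *\<^sub>v v))"
      using transpose_vec_mult_scalar[OF A v(1) Av] A v(1)
      by (metis At Av comm_scalar_prod mult_mat_vec_carrier)
    also have "\<dots> = v \<bullet> (?G *\<^sub>v v)"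
      using assoc_mult_mat_vec[OF At A v(1)] by simp
    also have "\<dots> = 0" using v by simp
    finally have "A *\<^sub>v v = 0\<^sub>v n"
      using Av by (simp add: conjugate_square_eq_0_vec[OF Av, symmetric])
    then show False
      using lin_depI[OF A v(1,2) _ dist] indpt by simp
  qed
  then obtain H where H: "H \<in> carrier_mat nc nc" "H * ?G = 1\<^sub>m nc"
    using det_non_zero_imp_unit[OF G, of "()"] unfolding Units_def ring_mat_def by auto
  show ?thesis
  proof (rule that)
    show "H * transpose_mat A \<in> carrier_mat nc n" using H A by simp
    show "H * transpose_mat A * A = 1\<^sub>m nc"
      using assoc_mult_mat[OF H(1) At A] H(2) by simp
  qed
qed

section \<open>Continuous inverses of strictly monotone functions\<close>

lemma strictly_monotone_inj:
  assumes "strictly_monotone f"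
  shows "inj f"
proof (rule injI)
  fix x y assume "f x = f y"
  moreover have "f a \<noteq> f b" if "a < b" for a b
    using assms that unfolding strictly_monotone_def strict_mono_def monotone_def by force
  ultimately show "x = y" by (metis linorder_neqE)
qed

text \<open>The range of \<open>f\<close> need not be all of \<open>\<real>\<close>, so \<open>y t\<close> may lie outside it at first. It is open,
  though: the intermediate value theorem on \<open>[x - e/2, x + e/2]\<close> finds preimages near \<open>x\<close> for all
  values near \<open>f x\<close>.\<close>

lemma tendsto_inv_of_strictly_monotone:
  assumes cont: "continuous_on UNIV f" and mono: "strictly_monotone f"
    and lim: "(y \<longlongrightarrow> f x) F"
  shows "((\<lambda>t. inv_into UNIV f (y t)) \<longlongrightarrow> x) F \<and> (\<forall>\<^sub>F t in F. f (inv_into UNIV f (y t)) = y t)"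
proof -
  have inj: "inj f" by (rule strictly_monotone_inj[OF mono])
  have pre: "\<forall>\<^sub>F t in F. f (inv_into UNIV f (y t)) = y t \<and> dist (inv_into UNIV f (y t)) x < e" if e: "e > 0" for e
  proof -
    define a where "a = x - e/2"
    define b where "b = x + e/2"
    have ab: "a < x" "x < b" "a \<le> b" using e by (auto simp: a_def b_def)
    have cont': "continuous_on {a..b} f"
      using cont continuous_on_subset by blast
    have "min (f a) (f b) < f x \<and> f x < max (f a) (f b)"
      using mono ab unfolding strictly_monotone_def strict_mono_def monotone_def
      by (metis less_max_iff_disj min_less_iff_disj)
    then have "\<forall>\<^sub>F t in F. min (f a) (f b) < y t \<and> y t < max (f a) (f b)"
      using order_tendstoD[OF lim] by (intro eventually_conj) auto
    then show ?thesis
    proof eventually_elim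
      case (elim t)
      have "\<exists>z. a \<le> z \<and> z \<le> b \<and> f z = y t"
      proof (cases "f a \<le> f b")
        case True
        then show ?thesis using IVT'[of f a "y t" b] elim ab cont' by auto
      next
        case False
        then show ?thesis using IVT2'[of f b "y t" a] elim ab cont' by auto
      qed
      then obtain z where z: "a \<le> z" "z \<le> b" "f z = y t" by blast
      then have "inv_into UNIV f (y t) = z" using inv_f_f[OF inj, of z] by simp
      moreover have "dist z x < e" using z e by (auto simp: a_def b_def dist_real_def)
      ultimately show ?case using z by simp
    qed
  qed
  have "((\<lambda>t. inv_into UNIV f (y t)) \<longlongrightarrow> x) F"
    by (rule tendstoI, rule eventually_mono[OF pre]) auto
  moreover have "\<forall>\<^sub>F t in F. f (inv_into UNIV f (y t)) = y t"
    by (rule eventually_mono[OF pre[of 1]]) auto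
  ultimately show ?thesis ..
qed

section \<open>Entrywise convergence of matrices\<close>

text \<open>The type of matrices of all sizes carries no topology, hence a notion of convergence for
  each fixed shape.\<close>

definition mat_tendsto ::
  "nat \<Rightarrow> nat \<Rightarrow> ('a \<Rightarrow> real mat) \<Rightarrow> real mat \<Rightarrow> 'a filter \<Rightarrow> bool" where
  "mat_tendsto r c A B F \<longleftrightarrow> (\<forall>t. A t \<in> carrier_mat r c) \<and> B \<in> carrier_mat r c \<and>
     (\<forall>i<r. \<forall>j<c. ((\<lambda>t. A t $$ (i, j)) \<longlongrightarrow> B $$ (i, j)) F)"

lemma mat_tendsto_const: "A \<in> carrier_mat r c \<Longrightarrow> mat_tendsto r c (\<lambda>_. A) A F"
  by (simp add: mat_tendsto_def)

lemma mat_tendsto_add: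
  assumes "mat_tendsto r c A A' F" "mat_tendsto r c B B' F"
  shows "mat_tendsto r c (\<lambda>t. A t + B t) (A' + B') F"
proof -
  have "dim_row (A t) = r \<and> dim_col (A t) = c \<and> dim_row (B t) = r \<and> dim_col (B t) = c" for t
    using assms by (metis mat_tendsto_def carrier_matD)
  then show ?thesis
    using assms by (auto simp: mat_tendsto_def intro!: tendsto_add)
qed

lemma mat_tendsto_diff:
  assumes "mat_tendsto r c A A' F" "mat_tendsto r c B B' F"
  shows "mat_tendsto r c (\<lambda>t. A t - B t) (A' - B') F"
proof -
  have "dim_row (A t) = r \<and> dim_col (A t) = c \<and> dim_row (B t) = r \<and> dim_col (B t) = c" for t
    using assms by (metis mat_tendsto_def carrier_matD)
  then show ?thesis
    using assms by (auto simp: mat_tendsto_def intro!: tendsto_diff minus_carrier_mat)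
qed

lemma mat_tendsto_mult:
  assumes A: "mat_tendsto r k A A' F" and B: "mat_tendsto k c B B' F"
  shows "mat_tendsto r c (\<lambda>t. A t * B t) (A' * B') F"
proof -
  have carrier: "A t \<in> carrier_mat r k" "B t \<in> carrier_mat k c"
      "A' \<in> carrier_mat r k" "B' \<in> carrier_mat k c" for t
    using assms by (simp_all add: mat_tendsto_def)
  have entry: "(M * N) $$ (i, j) = (\<Sum>m<k. M $$ (i, m) * N $$ (m, j))"
    if "M \<in> carrier_mat r k" "N \<in> carrier_mat k c" "i < r" "j < c" for M N :: "real mat" and i j
    using that by (simp add: scalar_prod_def lessThan_atLeast0)
  have "((\<lambda>t. (A t * B t) $$ (i, j)) \<longlongrightarrow> (A' * B') $$ (i, j)) F" if "i < r" "j < c" for i j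
    unfolding entry[OF carrier(1,2) that] entry[OF carrier(3,4) that]
    using assms that by (intro tendsto_sum tendsto_mult) (auto simp: mat_tendsto_def)
  then show ?thesis
    using mult_carrier_mat[OF carrier(1,2)] mult_carrier_mat[OF carrier(3,4)]
    by (simp add: mat_tendsto_def del: index_mult_mat)
qed

lemma mat_tendsto_map_inv:
  assumes cont: "continuous_on UNIV f" and mono: "strictly_monotone f"
    and B: "B \<in> carrier_mat r c" and Y: "mat_tendsto r c Y (map_mat f B) F"
  shows "mat_tendsto r c (\<lambda>t. map_mat (inv_into UNIV f) (Y t)) B F"
    and "\<forall>\<^sub>F t in F. map_mat f (map_mat (inv_into UNIV f) (Y t)) = Y t"
proof -
  have dim: "dim_row (Y t) = r" "dim_col (Y t) = c" for t
    using Y carrier_matD by (auto simp only: mat_tendsto_def)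
  have lim: "((\<lambda>t. Y t $$ (i, j)) \<longlongrightarrow> f (B $$ (i, j))) F" if "i < r" "j < c" for i j
    using that Y B by (auto simp: mat_tendsto_def)
  note inv = tendsto_inv_of_strictly_monotone[OF cont mono lim]
  show "mat_tendsto r c (\<lambda>t. map_mat (inv_into UNIV f) (Y t)) B F"
    using inv B by (auto simp: mat_tendsto_def dim intro: carrier_matI)
  have "\<forall>\<^sub>F t in F. \<forall>p\<in>{..<r} \<times> {..<c}. f (inv_into UNIV f (Y t $$ p)) = Y t $$ p"
    by (rule eventually_ball_finite) (use inv in auto)
  then show "\<forall>\<^sub>F t in F. map_mat f (map_mat (inv_into UNIV f) (Y t)) = Y t"
    by eventually_elim (rule eq_matI, auto simp: dim)
qed

section \<open>Lifting curves through the network\<close>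

lemma weight_space_carrier:
  "W \<in> weight_space h d \<Longrightarrow> i \<in> {1..h} \<Longrightarrow> W i \<in> carrier_mat (d i) (d (i - 1))"
  by (auto simp: weight_space_def)

lemma layer_carrier:
  assumes "X \<in> carrier_mat (d 0) n" "W \<in> weight_space h d" "i \<le> h"
  shows "layer \<sigma> X W i \<in> carrier_mat (d i) n"
  using assms(3)
proof (induction i)
  case (Suc i)
  then show ?case using weight_space_carrier[OF assms(2), of "Suc i"] by auto
qed (use assms(1) in simp)

lemma right_inverse_correction:
  fixes A R B G :: "real mat"
  assumes "A \<in> carrier_mat r k" "R \<in> carrier_mat k r" "A * R = 1\<^sub>m r"
    and "B \<in> carrier_mat k c" "G \<in> carrier_mat r c"
  shows "A * (B + R * (G - A * B)) = G"
proof -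
  have "A * (B + R * (G - A * B)) = A * B + A * (R * (G - A * B))"
    using assms by (intro mult_add_distrib_mat) auto
  also have "A * (R * (G - A * B)) = A * R * (G - A * B)"
    using assms by (intro assoc_mult_mat[symmetric]) auto
  also have "\<dots> = G - A * B" using assms by simp
  also have "A * B + (G - A * B) = G" using assms by (intro eq_matI) auto
  finally show ?thesis .
qed

lemma left_inverse_correction:
  fixes X P A G :: "real mat"
  assumes "X \<in> carrier_mat k c" "P \<in> carrier_mat c k" "P * X = 1\<^sub>m c"
    and "A \<in> carrier_mat r k" "G \<in> carrier_mat r c"
  shows "(A + (G - A * X) * P) * X = G"
proof -
  have "(A + (G - A * X) * P) * X = A * X + (G - A * X) * P * X"
    using assms by (intro add_mult_distrib_mat) auto
  also have "(G - A * X) * P * X = (G - A * X) * (P * X)"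
    using assms by (intro assoc_mult_mat) auto
  also have "\<dots> = G - A * X" using assms by simp
  also have "A * X + (G - A * X) = G" using assms by (intro eq_matI) auto
  finally show ?thesis .
qed

text \<open>The descent through the layers. The index is \<open>Suc i\<close> because layer \<open>0\<close> is the constant
  input \<open>X\<close>, which no weights can move. The intermediate curves need not be layer outputs of any
  network beforehand; that is why the induction ranges over all curves \<open>Y\<close>.\<close>

lemma layer_curve_lift:
  fixes \<sigma> :: "nat \<Rightarrow> real \<Rightarrow> real" and Y :: "'a \<Rightarrow> real mat"
  assumes X: "X \<in> carrier_mat (d 0) n" "vec_space.rank (d 0) X = n"
    and \<sigma>: "\<forall>i\<in>{1..h}. continuous_on UNIV (\<sigma> i) \<and> strictly_monotone (\<sigma> i)"
    and W: "W \<in> weight_space h d" "\<forall>i\<in>{1..h}. vec_space.rank (d i) (W i) = d i"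
    and "Suc i \<le> h" and "mat_tendsto (d (Suc i)) n Y (layer \<sigma> X W (Suc i)) F"
  shows "\<exists>U. mat_tendsto (d 1) (d 0) U (W 1) F \<and>
             (\<forall>\<^sub>F t in F. layer \<sigma> X (W(1 := U t)) (Suc i) = Y t)"
  using assms(6,7)
proof (induction i arbitrary: Y)
  case 0
  obtain P where P: "P \<in> carrier_mat n (d 0)" "P * X = 1\<^sub>m n"
    using full_column_rank_left_inverse[OF X] .
  have W1: "W 1 \<in> carrier_mat (d 1) (d 0)"
    using weight_space_carrier[OF W(1), of 1] 0(1) by simp
  have WX: "W 1 * X \<in> carrier_mat (d 1) n" using W1 X by simp
  define G where "G = (\<lambda>t. map_mat (inv_into UNIV (\<sigma> 1)) (Y t))"
  have G: "mat_tendsto (d 1) n G (W 1 * X) F"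
    and \<sigma>G: "\<forall>\<^sub>F t in F. map_mat (\<sigma> 1) (G t) = Y t"
    using mat_tendsto_map_inv[OF _ _ WX, of "\<sigma> 1" Y F] \<sigma> 0 by (auto simp: G_def)
  define U where "U t = W 1 + (G t - W 1 * X) * P" for t
  have "mat_tendsto (d 1) (d 0) U (W 1 + (W 1 * X - W 1 * X) * P) F"
    unfolding U_def using G W1 WX P
    by (intro mat_tendsto_add mat_tendsto_mult mat_tendsto_diff mat_tendsto_const) auto
  moreover have "W 1 + (W 1 * X - W 1 * X) * P = W 1"
    unfolding minus_r_inv_mat[OF WX] using W1 P by simp
  moreover have UX: "U t * X = G t" for t
    unfolding U_def using G W1 X P by (intro left_inverse_correction) (auto simp: mat_tendsto_def)
  ultimately show ?case
    using \<sigma>G by (intro exI[of _ U]) simp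
next
  case (Suc i)
  let ?L = "layer \<sigma> X W (Suc i)" and ?k = "Suc (Suc i)"
  have Wk: "W ?k \<in> carrier_mat (d ?k) (d (Suc i))"
    using weight_space_carrier[OF W(1), of ?k] Suc.prems(1) by simp
  have "vec_space.rank (d ?k) (W ?k) = d ?k"
    using W(2) Suc.prems(1) by simp
  then obtain R where R: "R \<in> carrier_mat (d (Suc i)) (d ?k)" "W ?k * R = 1\<^sub>m (d ?k)"
    using vec_space.full_row_rank_right_inverse[OF Wk] by blast
  have L: "?L \<in> carrier_mat (d (Suc i)) n"
    using layer_carrier[where i = "Suc i", OF X(1) W(1)] Suc.prems(1) by simp
  then have WL: "W ?k * ?L \<in> carrier_mat (d ?k) n" using Wk by simp
  define G where "G = (\<lambda>t. map_mat (inv_into UNIV (\<sigma> ?k)) (Y t))"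
  have cm: "continuous_on UNIV (\<sigma> ?k)" "strictly_monotone (\<sigma> ?k)"
    using \<sigma> Suc.prems(1) by auto
  have G: "mat_tendsto (d ?k) n G (W ?k * ?L) F"
    and \<sigma>G: "\<forall>\<^sub>F t in F. map_mat (\<sigma> ?k) (G t) = Y t"
    using mat_tendsto_map_inv[OF cm WL, of Y F] Suc.prems(2) by (auto simp: G_def)
  define Z where "Z t = ?L + R * (G t - W ?k * ?L)" for t
  have "mat_tendsto (d (Suc i)) n Z (?L + R * (W ?k * ?L - W ?k * ?L)) F"
    unfolding Z_def using G L WL R
    by (intro mat_tendsto_add mat_tendsto_mult mat_tendsto_diff mat_tendsto_const) auto
  moreover have "?L + R * (W ?k * ?L - W ?k * ?L) = ?L"
    unfolding minus_r_inv_mat[OF WL] using L R by (simp del: layer.simps)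
  ultimately have "mat_tendsto (d (Suc i)) n Z ?L F" by (simp del: layer.simps)
  then obtain U where U: "mat_tendsto (d 1) (d 0) U (W 1) F"
    and UZ: "\<forall>\<^sub>F t in F. layer \<sigma> X (W(1 := U t)) (Suc i) = Z t"
    using Suc.IH Suc.prems(1) by fastforce
  have WZ: "W ?k * Z t = G t" for t
    unfolding Z_def using G Wk L R
    by (intro right_inverse_correction) (auto simp: mat_tendsto_def)
  have "\<forall>\<^sub>F t in F. layer \<sigma> X (W(1 := U t)) ?k = Y t"
    using UZ \<sigma>G
  proof eventually_elim
    case (elim t)
    have "layer \<sigma> X (W(1 := U t)) ?k = map_mat (\<sigma> ?k) (W ?k * layer \<sigma> X (W(1 := U t)) (Suc i))"
      by (subst layer.simps) simp
    then show ?case using elim WZ by simp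
  qed
  with U show ?case by blast
qed

lemma weight_dist_first_tendsto_0:
  assumes "h \<ge> 1" "mat_tendsto (d 1) (d 0) U (W 1) F"
  shows "((\<lambda>t. weight_dist h d (W(1 := U t)) W) \<longlongrightarrow> 0) F"
proof -
  have "((\<lambda>t. (W(1 := U t)) i $$ (j, k)) \<longlongrightarrow> W i $$ (j, k)) F"
    if "j < d i" "k < d (i - 1)" for i j k
    using that assms(2) by (cases "i = 1") (auto simp: mat_tendsto_def)
  then have "((\<lambda>t. weight_dist h d (W(1 := U t)) W) \<longlongrightarrow>
      sqrt (\<Sum>i=1..h. \<Sum>j<d i. \<Sum>k<d (i - 1). (W i $$ (j, k) - W i $$ (j, k))\<^sup>2)) F"
    unfolding weight_dist_def by (intro tendsto_intros) auto
  then show ?thesis by simp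
qed

section \<open>Local minima are global\<close>

theorem mainTheorem5:
  fixes h n :: nat and d :: "nat \<Rightarrow> nat" and X :: "real mat"
    and \<sigma> :: "nat \<Rightarrow> real \<Rightarrow> real" and l :: "real mat \<Rightarrow> real" and W :: "nat \<Rightarrow> real mat"
  assumes "h \<ge> 1"
    and "n > 0"
    and "\<forall>i\<in>{0..h}. d i > 0"
    and "d 0 > n"
    and "\<forall>i\<in>{1..h}. d i \<le> d (i - 1)"
    and "X \<in> carrier_mat (d 0) n"
    and "vec_space.rank (d 0) X = n"
    and "\<forall>i\<in>{1..h}. continuous_on UNIV (\<sigma> i) \<and> strictly_monotone (\<sigma> i)"
    and "convex_on_carrier_mat (d h) n l"
    and "local_minimum h d (\<lambda>W. l (layer \<sigma> X W h)) W"
    and "\<forall>i\<in>{1..h}. vec_space.rank (d i) (W i) = d i"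
  shows "global_minimum h d (\<lambda>W. l (layer \<sigma> X W h)) W"
proof -
  let ?F = "at_right (0::real)"
  from assms(10) obtain e where W: "W \<in> weight_space h d" and e: "e > 0"
    and min: "\<And>V. V \<in> weight_space h d \<Longrightarrow> weight_dist h d V W < e \<Longrightarrow>
      l (layer \<sigma> X W h) \<le> l (layer \<sigma> X V h)"
    unfolding local_minimum_def by blast
  define L where "L = layer \<sigma> X W h"
  have L: "L \<in> carrier_mat (d h) n"
    unfolding L_def by (rule layer_carrier[OF assms(6) W]) simp
  have "l L \<le> l Z" if Z: "Z \<in> carrier_mat (d h) n" for Z
  proof -
    define Y where "Y t = (1 - t) \<cdot>\<^sub>m L + t \<cdot>\<^sub>m Z" for t
    \<comment> \<open>The segment from \<open>L\<close> to \<open>Z\<close> is a curve to be lifted to weights near \<open>W\<close>.\<close>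
    have "((\<lambda>t. (1 - t) * L $$ (i, j) + t * Z $$ (i, j)) \<longlongrightarrow>
        (1 - 0) * L $$ (i, j) + 0 * Z $$ (i, j)) ?F" for i j
      by (intro tendsto_intros)
    then have Y: "mat_tendsto (d h) n Y L ?F"
      using L Z by (auto simp: mat_tendsto_def Y_def)
    obtain h' where h': "h = Suc h'" using assms(1) by (cases h) auto
    obtain U where U: "mat_tendsto (d 1) (d 0) U (W 1) ?F"
      and UY: "\<forall>\<^sub>F t in ?F. layer \<sigma> X (W(1 := U t)) h = Y t"
      using layer_curve_lift[OF assms(6,7,8) W assms(11), of h' Y ?F] Y
      unfolding L_def h' by blast
    have V: "W(1 := U t) \<in> weight_space h d" for t
      using W U assms(1) by (auto simp: weight_space_def mat_tendsto_def PiE_iff extensional_def)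
    have "\<forall>\<^sub>F t in ?F. weight_dist h d (W(1 := U t)) W < e"
      using order_tendstoD(2)[OF weight_dist_first_tendsto_0[where W = W and U = U and F = ?F, OF assms(1) U] e] .
    moreover have "\<forall>\<^sub>F t in ?F. 0 < t \<and> t < 1"
      unfolding eventually_at_right_field by (rule exI[of _ 1]) auto
    ultimately have "\<forall>\<^sub>F t in ?F. layer \<sigma> X (W(1 := U t)) h = Y t \<and>
        weight_dist h d (W(1 := U t)) W < e \<and> 0 < t \<and> t < 1"
      using UY by eventually_elim simp
    then obtain t where t: "layer \<sigma> X (W(1 := U t)) h = Y t"
        "weight_dist h d (W(1 := U t)) W < e" "0 < t" "t < 1"
      using eventually_happens'[of ?F] by force
    have "l L \<le> l (Y t)"
      using min[OF V t(2)] t(1) by (simp add: L_def)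
    also have "\<dots> \<le> (1 - t) * l L + t * l Z"
      using assms(9) L Z t(3,4) unfolding convex_on_carrier_mat_def Y_def by simp
    finally have "t * l L \<le> t * l Z" by (simp add: algebra_simps)
    then show ?thesis using t(3) by simp
  qed
  then show ?thesis
    unfolding global_minimum_def using W \<open>\<And>Z. Z \<in> carrier_mat (d h) n \<Longrightarrow> l L \<le> l Z\<close>
      layer_carrier[where \<sigma> = \<sigma> and d = d and i = h, OF assms(6)] L_def by blast
qed

end
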